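(* Let $T$ be a tree with $m$ edges and maximum degree $\Delta$, and let $t$ be the number of vertices of $T$ of degree at least $3$. Then $$N(T)\leq 2\lceil\log_2 m\rceil+\mathcal{R}(\Delta)+t.$$
   Context: $\mathcal{R}(s)=\min\{c : \binom{c}{\lfloor c/2\rfloor}\geq s\}$. For a graph $G$, a covering of $G$ is a collection of subsets $A_1,\ldots,A_n$ of $V(G)$ such that for every edge $\{u,v\}$ and every vertex $x\notin\{u,v\}$ there is some $A_j$ with $\{u,v\}\subseteq A_j$ and $x\notin A_j$; $N(G)$ is the minimum size of a covering of $G$. *)

theory Defs
  imports Complex_Main
begin

text \<open>A graph is a vertex set together with a set of edges, each edge being a two-element set of
  vertices. (In \<open>Graph_Theory\<close>, a pair of antiparallel arcs counts as a cycle, so its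
  notion of tree does not describe undirected trees represented as symmetric digraphs.)\<close>

definition simple_graph :: "'a set \<Rightarrow> 'a set set \<Rightarrow> bool" where
  "simple_graph V E \<longleftrightarrow> finite V \<and> (\<forall>e\<in>E. e \<subseteq> V \<and> card e = 2)"

definition adjacent :: "'a set set \<Rightarrow> 'a \<Rightarrow> 'a \<Rightarrow> bool" where
  "adjacent E u v \<longleftrightarrow> {u, v} \<in> E"

definition connected_graph :: "'a set \<Rightarrow> 'a set set \<Rightarrow> bool" where
  "connected_graph V E \<longleftrightarrow> V \<noteq> {} \<and> (\<forall>u\<in>V. \<forall>v\<in>V. (adjacent E)\<^sup>*\<^sup>* u v)"

definition is_cycle :: "'a set set \<Rightarrow> 'a list \<Rightarrow> bool" where
  "is_cycle E vs \<longleftrightarrow> 3 \<le> length vs \<and> distinct vs \<and> successively (adjacent E) vs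
    \<and> adjacent E (last vs) (hd vs)"

definition tree :: "'a set \<Rightarrow> 'a set set \<Rightarrow> bool" where
  "tree V E \<longleftrightarrow> simple_graph V E \<and> connected_graph V E \<and> \<not> (\<exists>vs. is_cycle E vs)"

definition degree :: "'a set set \<Rightarrow> 'a \<Rightarrow> nat" where
  "degree E v = card {e \<in> E. v \<in> e}"

definition max_degree :: "'a set \<Rightarrow> 'a set set \<Rightarrow> nat" where
  "max_degree V E = Max (degree E ` V)"

definition covering :: "'a set \<Rightarrow> 'a set set \<Rightarrow> 'a set list \<Rightarrow> bool" where
  "covering V E As \<longleftrightarrow> (\<forall>A\<in>set As. A \<subseteq> V)
    \<and> (\<forall>e\<in>E. \<forall>x\<in>V - e. \<exists>A\<in>set As. e \<subseteq> A \<and> x \<notin> A)"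

definition covering_number :: "'a set \<Rightarrow> 'a set set \<Rightarrow> nat" where
  "covering_number V E = (LEAST n. \<exists>As. covering V E As \<and> length As = n)"

definition sperner_number :: "nat \<Rightarrow> nat" where
  "sperner_number s = (LEAST c. s \<le> c choose (c div 2))"

text \<open>Both minima range over nonempty sets.\<close>

lemma covering_exists:
  assumes "simple_graph V E"
  shows "\<exists>As. covering V E As"
proof -
  have "finite (Pow V)" using assms by (simp add: simple_graph_def)
  from finite_list[OF this] obtain As where As: "set As = Pow V" ..
  have sub: "e \<subseteq> V" if "e \<in> E" for e
    using that assms unfolding simple_graph_def by blast
  have "covering V E As"
    unfolding covering_def As
  proof (intro conjI ballI)
    fix e x assume "e \<in> E" "x \<in> V - e"
    then show "\<exists>A\<in>Pow V. e \<subseteq> A \<and> x \<notin> A"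
      using sub[of e] by blast
  qed simp
  then show ?thesis ..
qed

lemma sperner_number_exists: "\<exists>c. s \<le> c choose (c div 2)"
proof
  show "s \<le> s choose (s div 2)"
    using binomial_maximum[of s 1] by simp
qed

end

theory Submission
  imports Defs "HOL-Library.Sublist"
begin

text \<open>Give every edge a binary code of \<open>k = \<lceil>log\<^sub>2 m\<rceil>\<close> bits and take, for each
  position \<open>i\<close> and bit \<open>b\<close>, the union of the edges whose code has \<open>b\<close> at position \<open>i\<close>.
  These \<open>2k\<close> sets separate an edge \<open>e\<close> from a vertex \<open>x\<close> as soon as some bit of the code of \<open>e\<close>
  differs from that bit in the codes of all edges at \<open>x\<close>. If \<open>x\<close> is a leaf, it suffices that the
  codes are distinct. If \<open>x\<close> has degree 2, it suffices that moreover the codes of its two edges differ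
  in a single position, because then no third code agrees with one or the other of them everywhere.
  Both hold if the edges are numbered so that the two edges at each vertex of degree 2 are consecutive,
  and are then coded by a Gray code. A vertex \<open>x\<close> of degree at least 3 is dealt with by the single set
  \<open>V - {x}\<close>.\<close>

section \<open>Gray codes\<close>

text \<open>The reflected binary Gray code: since the second copy is reversed, the two words at the
  junction have the same tail.\<close>

fun gray :: "nat \<Rightarrow> bool list list" where
  "gray 0 = [[]]"
| "gray (Suc k) = map (Cons False) (gray k) @ map (Cons True) (rev (gray k))"

text \<open>An update may keep the old entry or point outside the list, so this amounts to equal
  lengths and at most one differing position.\<close>

definition one_flip :: "'b list \<Rightarrow> 'b list \<Rightarrow> bool" where
  "one_flip u v \<longleftrightarrow> (\<exists>i b. v = u[i := b])"

lemma one_flip_sym: "one_flip u v \<Longrightarrow> one_flip v u"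
  unfolding one_flip_def by (metis list_update_id list_update_overwrite)

lemma one_flip_Cons: "one_flip u v \<Longrightarrow> one_flip (a # u) (a # v)"
  unfolding one_flip_def by (metis list_update_code(3))

lemma one_flip_hd: "one_flip (a # u) (b # u)"
  unfolding one_flip_def by (metis list_update_code(2))

lemma length_gray: "length (gray k) = 2 ^ k"
  by (induction k) auto

lemma length_in_gray: "u \<in> set (gray k) \<Longrightarrow> length u = k"
  by (induction k arbitrary: u) auto

lemma distinct_gray: "distinct (gray k)"
  by (induction k) (auto simp: distinct_map)

lemma successively_one_flip_gray: "successively one_flip (gray k)"
proof (induction k)
  case (Suc k)
  have ne: "gray k \<noteq> []" using length_gray[of k] by auto
  have "successively one_flip (map (Cons False) (gray k))"
    unfolding successively_map
    by (rule successively_mono[OF Suc]) (auto intro: one_flip_Cons)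
  moreover have "successively one_flip (map (Cons True) (rev (gray k)))"
    unfolding successively_map successively_rev
    by (rule successively_mono[OF Suc]) (auto intro: one_flip_Cons one_flip_sym)
  ultimately show ?case
    using ne by (simp add: successively_append_iff last_map hd_map hd_rev one_flip_hd)
qed simp

text \<open>Away from the flipped position \<open>u\<close> and \<open>v\<close> agree, so differing
  from one there is differing from both. If \<open>w\<close> agrees with \<open>u\<close> at all
  those positions, it must differ from both words at the flipped one.\<close>

lemma one_flip_separates:
  assumes "one_flip u v" "length w = length u" "w \<noteq> u" "w \<noteq> v"
  shows "\<exists>j < length u. w ! j \<noteq> u ! j \<and> w ! j \<noteq> v ! j"
proof (rule ccontr)
  assume none: "\<not> ?thesis"
  obtain i b where v: "v = u[i := b]" using assms(1) unfolding one_flip_def by blast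
  have off: "w ! j = u ! j" if "j < length u" "j \<noteq> i" for j
    using none that by (auto simp: v)
  show False
  proof (cases "i < length u \<and> w ! i \<noteq> u ! i")
    case True
    then have "w ! i = v ! i" using none by blast
    then have "w ! j = v ! j" if "j < length u" for j
      using off[OF that] by (cases "j = i") (auto simp: v)
    then have "w = v" using assms(2) by (intro nth_equalityI) (auto simp: v)
    then show False using assms(4) by simp
  next
    case False
    then have "w = u" using off assms(2) by (metis nth_equalityI)
    then show False using assms(3) by simp
  qed
qed

lemma successively_sublist:
  "successively P xs \<Longrightarrow> sublist [x, y] xs \<Longrightarrow> P x y"
  by (auto simp: sublist_def successively_append_iff)

lemma ex_map_eq:
  assumes "distinct xs" "length xs = length ys"
  shows "\<exists>f. map f xs = ys"
proof
  show "map (\<lambda>x. the (map_of (zip xs ys) x)) xs = ys"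
    using assms by (intro nth_equalityI) (auto simp: map_of_zip_nth)
qed

section \<open>Numbering the edges of a forest\<close>

text \<open>Connectedness is left out so that deleting edges stays within the class, as the
  induction on edges requires.\<close>

definition forest :: "'a set set \<Rightarrow> bool" where
  "forest E \<longleftrightarrow> finite E \<and> (\<forall>e\<in>E. card e = 2) \<and> \<not> (\<exists>vs. is_cycle E vs)"

lemma forest_subset:
  assumes "forest E" "F \<subseteq> E"
  shows "forest F"
proof -
  have "is_cycle E vs" if "is_cycle F vs" for vs
    using that assms(2) successively_mono[of "adjacent F" vs "adjacent E"]
    unfolding is_cycle_def adjacent_def by blast
  then show ?thesis using assms unfolding forest_def by (meson finite_subset subsetD)
qed

text \<open>The first vertex \<open>l\<close> of a longest path is a leaf: a second neighbour would
  extend the path if it lay off it, and would close a cycle if it lay on it.\<close>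

lemma forest_leaf:
  assumes "forest E" "E \<noteq> {}"
  shows "\<exists>l w. l \<noteq> w \<and> {e \<in> E. l \<in> e} = {{l, w}}"
proof -
  have card2: "card e = 2" if "e \<in> E" for e using assms(1) that unfolding forest_def by blast
  have fin: "finite (\<Union>E)"
    using assms(1) unfolding forest_def by (metis card.infinite finite_Union zero_neq_numeral)
  define path where
    "path vs \<longleftrightarrow> distinct vs \<and> successively (adjacent E) vs \<and> set vs \<subseteq> \<Union>E" for vs
  obtain a b where ab: "{a, b} \<in> E" "a \<noteq> b"
    using assms(2) card2 by (metis card_2_iff ex_in_conv)
  have path_ab: "path [a, b]" using ab unfolding path_def adjacent_def by auto
  have bound: "\<forall>vs. path vs \<longrightarrow> length vs < Suc (card (\<Union>E))"
    unfolding path_def using card_mono[OF fin] distinct_card by (metis le_imp_less_Suc)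
  obtain vs where vs: "path vs" and max: "\<And>us. path us \<Longrightarrow> length us \<le> length vs"
    using ex_has_greatest_nat[of path "[a, b]" length, OF path_ab bound] by blast
  have "2 \<le> length vs" using max[OF path_ab] by simp
  then obtain l w ws where lw: "vs = l # w # ws"
    by (metis One_nat_def Suc_1 Suc_le_length_iff)
  have e: "{l, w} \<in> E" "l \<noteq> w" using vs unfolding lw path_def adjacent_def by auto
  have "f = {l, w}" if f: "f \<in> E" "l \<in> f" for f
  proof (rule ccontr)
    assume "f \<noteq> {l, w}"
    then obtain y where y: "f = {l, y}" "y \<noteq> l" "y \<noteq> w"
      using card2[OF f(1)] f(2) by (auto simp: card_2_iff)
    have adj: "adjacent E y l" using f(1) y(1) unfolding adjacent_def by (simp add: insert_commute)
    show False
    proof (cases "y \<in> set vs")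
      case False
      have "path (y # vs)"
        using vs False adj f(1) y(1) unfolding path_def lw by auto
      then show False using max by fastforce
    next
      case True
      \<comment> \<open>Since \<open>y\<close> is neither \<open>l\<close> nor \<open>w\<close>, it
        lies in \<open>ws\<close>, so the cycle has at least three vertices.\<close>
      then obtain as bs where "ws = as @ y # bs" using y lw by (auto simp: in_set_conv_decomp)
      then have "is_cycle E (l # w # as @ [y])"
        using vs adj unfolding is_cycle_def path_def lw
        by (auto simp: successively_append_iff successively_Cons hd_append split: if_splits)
      then show False using assms(1) unfolding forest_def by blast
    qed
  qed
  then have "{e \<in> E. l \<in> e} = {{l, w}}" using e(1) by blast
  then show ?thesis using e(2) by metis
qed

definition consecutive :: "'b list \<Rightarrow> 'b \<Rightarrow> 'b \<Rightarrow> bool" where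
  "consecutive xs p q \<longleftrightarrow> sublist [p, q] xs \<or> sublist [q, p] xs"

lemma consecutive_sym: "consecutive xs p q \<Longrightarrow> consecutive xs q p"
  unfolding consecutive_def by blast

lemma consecutive_rev [simp]: "consecutive (rev xs) p q \<longleftrightarrow> consecutive xs p q"
  unfolding consecutive_def using sublist_rev[of "[p, q]" xs] sublist_rev[of "[q, p]" xs]
  by (metis append_Cons append_Nil rev.simps sublist_rev_left)

text \<open>Inserting \<open>e\<close> just after \<open>f\<close> separates only \<open>f\<close>
  from its right neighbour.\<close>

lemma consecutive_insert:
  assumes "consecutive (as @ f # bs) p q" "p \<noteq> f" "q \<noteq> f"
  shows "consecutive (as @ f # e # bs) p q"
proof -
  have *: "sublist [p, q] (as @ f # e # bs)"
    if "sublist [p, q] (as @ f # bs)" and "p \<noteq> f" "q \<noteq> f" for p q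
  proof -
    have "sublist [p, q] as \<or> sublist [p, q] bs"
      using that by (auto simp: sublist_append sublist_Cons_right Cons_eq_append_conv)
    then show ?thesis
      by (auto simp: sublist_append sublist_Cons_right)
  qed
  show ?thesis using assms * unfolding consecutive_def by metis
qed

lemma consecutive_split:
  assumes "consecutive xs f h"
  shows "\<exists>as bs. xs = as @ h # f # bs \<or> rev xs = as @ h # f # bs"
proof -
  consider "sublist [h, f] xs" | "sublist [h, f] (rev xs)"
    using assms sublist_rev[of "[f, h]" xs] unfolding consecutive_def by auto
  then show ?thesis by cases (auto simp: sublist_def)
qed

text \<open>Induction on the number of edges: remove the edge \<open>e = {l, w}\<close> at a leaf
  \<open>l\<close>, number the rest and put \<open>e\<close> back. A new constraint arises only if
  \<open>w\<close> has exactly one other edge \<open>f\<close>, and then \<open>e\<close> must stand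
  next to \<open>f\<close>. Before that, \<open>f\<close> is tied to at most one edge, through its
  other end, so one side of it is free.\<close>

lemma forest_numbering:
  assumes "forest E"
  shows "\<exists>es. distinct es \<and> set es = E \<and>
    (\<forall>x f g. f \<noteq> g \<longrightarrow> {e \<in> E. x \<in> e} = {f, g} \<longrightarrow> consecutive es f g)"
  using assms
proof (induction "card E" arbitrary: E)
  case 0
  then show ?case unfolding forest_def by (intro exI[of _ "[]"]) auto
next
  case (Suc n)
  have card2: "card e = 2" if "e \<in> E" for e
    using Suc.prems that unfolding forest_def by auto
  have "E \<noteq> {}" using Suc.hyps(2) by auto
  then obtain l w where lw: "l \<noteq> w" "{e \<in> E. l \<in> e} = {{l, w}}"
    using forest_leaf[OF Suc.prems] by blast
  define e where "e = {l, w}"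
  define F where "F = E - {e}"
  have eE: "e \<in> E" using lw unfolding e_def by blast
  have inc: "{d \<in> E. x \<in> d} = {d \<in> F. x \<in> d}" if "x \<noteq> l" "x \<noteq> w" for x
    using that unfolding F_def e_def by auto
  have incw: "{d \<in> E. w \<in> d} = insert e {d \<in> F. w \<in> d}"
    using eE unfolding F_def e_def by auto
  have "n = card F" using Suc.hyps(2) eE unfolding F_def by simp
  moreover have "forest F" using forest_subset[OF Suc.prems] unfolding F_def by blast
  ultimately obtain es where es: "distinct es" "set es = F"
    and cons: "\<And>x f g. f \<noteq> g \<Longrightarrow> {d \<in> F. x \<in> d} = {f, g} \<Longrightarrow> consecutive es f g"
    using Suc.hyps(1) by blast
  have eF: "e \<notin> set es" using es(2) unfolding F_def by simp
  show ?case
  proof (cases "\<exists>f. {d \<in> F. w \<in> d} = {f}")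
    \<comment> \<open>The degree of \<open>w\<close> in \<open>E\<close> is not 2, so
      \<open>e\<close> is subject to no constraint and may go in front.\<close>
    case False
    have "consecutive (e # es) f g" if "f \<noteq> g" "{d \<in> E. x \<in> d} = {f, g}" for x f g
    proof -
      have "x \<noteq> l" using that lw(2) by (metis doubleton_eq_iff insert_absorb2)
      moreover have "x \<noteq> w"
      proof
        assume "x = w"
        then have "insert e {d \<in> F. w \<in> d} = {f, g}" using that(2) incw by simp
        moreover have "e \<notin> {d \<in> F. w \<in> d}" unfolding F_def by simp
        ultimately have "{d \<in> F. w \<in> d} = {f, g} - {e}" "e \<in> {f, g}" by blast+
        then show False using False that(1) by (cases "e = f") auto
      qed
      ultimately have "consecutive es f g" using that cons inc by metis
      then show ?thesis unfolding consecutive_def by (auto simp: sublist_Cons_right)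
    qed
    moreover have "distinct (e # es)" "set (e # es) = E"
      using es eF eE unfolding F_def by auto
    ultimately show ?thesis by (intro exI[of _ "e # es"] conjI allI impI)
  next
    case True
    then obtain f where f: "{d \<in> F. w \<in> d} = {f}" ..
    then have fF: "f \<in> F" "w \<in> f" by auto
    then have "card f = 2" using card2 unfolding F_def by blast
    then obtain z where z: "f = {w, z}" "z \<noteq> w" using fF(2) by (auto simp: card_2_iff)
    \<comment> \<open>The only edge of \<open>F\<close> at \<open>w\<close> is \<open>f\<close>, so
      a neighbour of \<open>f\<close> in the numbering can be prescribed only through
      \<open>z\<close>.\<close>
    define Z where "Z = {d \<in> F. z \<in> d}"
    \<comment> \<open>Up to reversal, the only other edge that must stay next to \<open>f\<close> stands on its left, so
      \<open>e\<close> can be inserted on its right.\<close>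
    have "\<exists>as bs. (as @ f # bs = es \<or> as @ f # bs = rev es) \<and>
      (\<forall>h. h \<noteq> f \<longrightarrow> Z = {f, h} \<longrightarrow> as \<noteq> [] \<and> last as = h)"
    proof (cases "\<exists>h. h \<noteq> f \<and> Z = {f, h}")
      case True
      then obtain h where h: "h \<noteq> f" "Z = {f, h}" by blast
      then have "consecutive es f h" using cons[of f h z] unfolding Z_def by simp
      then obtain as bs where "es = as @ h # f # bs \<or> rev es = as @ h # f # bs"
        using consecutive_split by metis
      moreover have "h' = h" if "Z = {f, h'}" for h'
        using that h by (metis doubleton_eq_iff)
      ultimately show ?thesis
        by (intro exI[of _ "as @ [h]"] exI[of _ bs]) auto
    next
      case False
      obtain as bs where "es = as @ f # bs" using fF(1) es(2) by (metis split_list)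
      then show ?thesis using False by (intro exI[of _ as] exI[of _ bs]) auto
    qed
    then obtain as bs where eq: "as @ f # bs = es \<or> as @ f # bs = rev es"
      and left: "\<And>h. h \<noteq> f \<Longrightarrow> Z = {f, h} \<Longrightarrow> as \<noteq> [] \<and> last as = h"
      by metis
    define fs where "fs = as @ f # e # bs"
    have old: "consecutive (as @ f # bs) p q \<longleftrightarrow> consecutive es p q" for p q
      using eq by auto
    have near: "consecutive fs f h" if h: "h \<noteq> f" "Z = {f, h}" for h
    proof -
      obtain as' where "as = as' @ [h]" using left[OF h] by (metis append_butlast_last_id)
      then have "fs = as' @ [h, f] @ e # bs" unfolding fs_def by simp
      then show ?thesis unfolding consecutive_def sublist_def by metis
    qed
    have set: "set (as @ f # bs) = F" using eq es(2) by (metis set_rev)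
    have "distinct (as @ f # bs)" using eq es(1) by (metis distinct_rev)
    then have "distinct fs" using eF unfolding es(2) set[symmetric] fs_def by auto
    moreover have "consecutive fs p q" if pq: "p \<noteq> q" "{d \<in> E. x \<in> d} = {p, q}" for x p q
    proof -
      have xl: "x \<noteq> l" using that lw(2) by (metis doubleton_eq_iff insert_absorb2)
      show ?thesis
      proof (cases "x = w")
        case True
        then have "{p, q} = {e, f}" using pq incw f by simp
        moreover have "sublist [f, e] fs"
          unfolding fs_def sublist_def by (metis append_Cons append_Nil)
        ultimately show ?thesis unfolding consecutive_def by (auto simp: doubleton_eq_iff)
      next
        case False
        then have F: "{d \<in> F. x \<in> d} = {p, q}" using inc[OF xl] pq by simp
        show ?thesis
        \<comment> \<open>A pair containing \<open>f\<close> at a vertex other than \<open>w\<close>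
          belongs to \<open>z\<close> and is kept by the choice of side; a pair without
          \<open>f\<close> survives the insertion.\<close>
        proof (cases "f \<in> {p, q}")
          case True
          then have "x \<in> f" using F by blast
          then have "x = z" using False z by blast
          then have "Z = {p, q}" using F unfolding Z_def by simp
          then show ?thesis
            using True near pq(1) by (metis consecutive_sym insert_commute insertE singletonD)
        next
          case nf: False
          have "consecutive es p q" using cons[OF pq(1) F] .
          then show ?thesis using nf consecutive_insert[of as f bs p q e] old unfolding fs_def by auto
        qed
      qed
    qed
    moreover have "set fs = E"
    proof -
      have "set fs = insert e F" unfolding fs_def set[symmetric] by auto
      then show ?thesis using eE unfolding F_def by (simp only: insert_Diff)
    qed
    ultimately show ?thesis by (intro exI[of _ fs] conjI allI impI)
  qed
qed

section \<open>The covering\<close>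

text \<open>The edges, in the order of the numbering, receive the first \<open>card E\<close> words
  of the Gray code, so consecutive edges get successive words.\<close>

lemma forest_coding:
  assumes "forest E" "card E \<le> 2 ^ k"
  shows "\<exists>c :: 'a set \<Rightarrow> bool list. (\<forall>e\<in>E. length (c e) = k) \<and> inj_on c E \<and>
    (\<forall>x f g. f \<noteq> g \<longrightarrow> {e \<in> E. x \<in> e} = {f, g} \<longrightarrow> one_flip (c f) (c g))"
proof -
  obtain es where es: "distinct es" "set es = E"
    and cons: "\<And>x f g. f \<noteq> g \<Longrightarrow> {e \<in> E. x \<in> e} = {f, g} \<Longrightarrow> consecutive es f g"
    using forest_numbering[OF assms(1)] by blast
  define gs where "gs = take (length es) (gray k)"
  have "length es = length gs"
    using es assms(2) distinct_card[of es] by (simp add: gs_def length_gray)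
  then obtain c where c: "map c es = gs" using ex_map_eq es(1) by blast
  have "successively one_flip (gs @ drop (length es) (gray k))"
    using successively_one_flip_gray[of k] by (simp add: gs_def)
  then have "successively one_flip (map c es)"
    unfolding c successively_append_iff by blast
  then have adj: "one_flip (c f) (c g)" if "consecutive es f g" for f g
    using that unfolding consecutive_def successively_map
    by (metis (mono_tags, lifting) one_flip_sym successively_sublist)
  have "inj_on c E"
    using distinct_gray[of k] c es by (metis distinct_map distinct_take gs_def)
  moreover have "length (c e) = k" if "e \<in> E" for e
  proof -
    have "c e \<in> set gs" using that c es(2) by (metis image_eqI set_map)
    then show ?thesis using in_set_takeD length_in_gray unfolding gs_def by metis
  qed
  moreover have "one_flip (c f) (c g)" if "f \<noteq> g" "{e \<in> E. x \<in> e} = {f, g}" for x f g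
    using adj[OF cons[OF that]] .
  ultimately show ?thesis by (intro exI[of _ c] conjI ballI allI impI)
qed

text \<open>Two sets for each code position and one for each vertex of degree at least 3. Keeping
  \<open>k\<close> general leaves the logarithm to the final theorem.\<close>

lemma tree_covering_number_le:
  assumes tree: "tree V E" and card: "card E \<le> 2 ^ k"
  shows "covering_number V E \<le> 2 * k + card {v \<in> V. degree E v \<ge> 3}"
proof -
  have V: "finite V" and sub: "\<And>e. e \<in> E \<Longrightarrow> e \<subseteq> V" and card2: "\<And>e. e \<in> E \<Longrightarrow> card e = 2"
    using tree unfolding tree_def simple_graph_def by auto
  have finE: "finite E" using V sub by (meson finite_Pow_iff finite_subset PowI subsetI)
  have forest: "forest E" using tree finE card2 unfolding tree_def forest_def by blast
  obtain c :: "'a set \<Rightarrow> bool list" where len: "\<And>e. e \<in> E \<Longrightarrow> length (c e) = k"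
    and inj: "inj_on c E"
    and flip: "\<And>x f g. f \<noteq> g \<Longrightarrow> {e \<in> E. x \<in> e} = {f, g} \<Longrightarrow> one_flip (c f) (c g)"
    using forest_coding[OF forest card] by metis
  have sep: "\<exists>j<k. \<forall>f\<in>E. x \<in> f \<longrightarrow> c f ! j \<noteq> c e ! j"
    if e: "e \<in> E" and x: "x \<in> V - e" and deg: "\<not> degree E x \<ge> 3" for e x
  proof -
    have ne: "c f \<noteq> c e" if "f \<in> E" "x \<in> f" for f
      using that e x inj by (metis DiffD2 inj_onD)
    obtain u where u: "u \<in> e" using card2[OF e] by (metis card.empty ex_in_conv zero_neq_numeral)
    \<comment> \<open>Connectedness excludes degree 0: as \<open>x\<close> is not in
      \<open>e\<close>, a walk from \<open>x\<close> to \<open>u\<close> has a first edge, and it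
      contains \<open>x\<close>.\<close>
    then have "(adjacent E)\<^sup>*\<^sup>* x u"
      using tree sub[OF e] x unfolding tree_def connected_graph_def by blast
    then obtain y where "{x, y} \<in> E"
      using u x by (metis DiffD2 adjacent_def converse_rtranclpE)
    then have "{f \<in> E. x \<in> f} \<noteq> {}" by blast
    moreover have fin: "finite {f \<in> E. x \<in> f}" using finE by simp
    ultimately have "card {f \<in> E. x \<in> f} \<noteq> 0" by simp
    then consider "card {f \<in> E. x \<in> f} = 1" | "card {f \<in> E. x \<in> f} = 2"
      using deg unfolding degree_def by linarith
    then show ?thesis
    proof cases
      case 1
      then obtain f where f: "{f \<in> E. x \<in> f} = {f}" by (metis card_1_singletonE)
      then have fE: "f \<in> E" "x \<in> f" by auto
      obtain j where "j < k" "c f ! j \<noteq> c e ! j"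
        using ne[OF fE] len[OF fE(1)] len[OF e] nth_equalityI[of "c f" "c e"] by auto
      moreover have "d = f" if "d \<in> E" "x \<in> d" for d using f that by blast
      ultimately show ?thesis by blast
    next
      case 2
      then obtain f g where fg: "{f \<in> E. x \<in> f} = {f, g}" "f \<noteq> g" by (metis card_2_iff)
      then have fgE: "f \<in> E" "x \<in> f" "g \<in> E" "x \<in> g" by blast+
      \<comment> \<open>The code of \<open>e\<close> is the third word; it differs from the other
        two because \<open>x\<close> lies in \<open>f\<close> and \<open>g\<close> but not in
        \<open>e\<close>.\<close>
      obtain j where "j < k" "c e ! j \<noteq> c f ! j" "c e ! j \<noteq> c g ! j"
        using one_flip_separates[OF flip[OF fg(2,1)], of "c e"] len e fgE ne by metis
      moreover have "d = f \<or> d = g" if "d \<in> E" "x \<in> d" for d using fg that by blast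
      ultimately show ?thesis by metis
    qed
  qed
  define A where "A b i = \<Union>{e \<in> E. c e ! i = b}" for b i
  obtain xs where xs: "set xs = {v \<in> V. degree E v \<ge> 3}" "distinct xs"
    using finite_distinct_list[of "{v \<in> V. degree E v \<ge> 3}"] V by auto
  define As where
    "As = map (A True) [0..<k] @ map (A False) [0..<k] @ map (\<lambda>x. V - {x}) xs"
  have A_in: "A b i \<in> set As" if "i < k" for b i
    using that by (cases b) (auto simp: As_def)
  have "covering V E As"
    unfolding covering_def
  proof (intro conjI ballI)
    show "S \<subseteq> V" if "S \<in> set As" for S
      using that sub by (auto simp: As_def A_def)
  next
    fix e x assume e: "e \<in> E" and x: "x \<in> V - e"
    show "\<exists>S\<in>set As. e \<subseteq> S \<and> x \<notin> S"
    proof (cases "degree E x \<ge> 3")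
      case True
      then have "V - {x} \<in> set As" using x xs(1) by (auto simp: As_def)
      then show ?thesis using sub[OF e] x by (intro bexI[of _ "V - {x}"]) auto
    next
      case False
      then obtain j where j: "j < k" "\<forall>f\<in>E. x \<in> f \<longrightarrow> c f ! j \<noteq> c e ! j"
        using sep[OF e x] by blast
      \<comment> \<open>If \<open>x\<close> were in this set, some edge at \<open>x\<close> would
        share bit \<open>j\<close> with \<open>e\<close>, against the choice of
        \<open>j\<close>.\<close>
      have "e \<subseteq> A (c e ! j) j" "x \<notin> A (c e ! j) j" using e j(2) unfolding A_def by blast+
      then show ?thesis using A_in[OF j(1)] by (intro bexI[of _ "A (c e ! j) j"]) auto
    qed
  qed
  moreover have "length As = 2 * k + card {v \<in> V. degree E v \<ge> 3}"
    using xs distinct_card[of xs] by (simp add: As_def)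
  ultimately show ?thesis unfolding covering_number_def by (intro Least_le) metis
qed

theorem theorem3p9:
  fixes V :: "'a set" and E :: "'a set set" and m \<Delta> t :: nat
  assumes "tree V E"
    and "card E = m"
    and "max_degree V E = \<Delta>"
    and "card {v \<in> V. degree E v \<ge> 3} = t"
  shows "int (covering_number V E) \<le> 2 * \<lceil>log 2 (real m)\<rceil> + int (sperner_number \<Delta>) + int t"
proof -
  define k where "k = nat \<lceil>log 2 (real m)\<rceil>"
  \<comment> \<open>For \<open>m = 0\<close> the junk value is \<open>log 2 0 = 0\<close>.\<close>
  have log0: "0 \<le> log 2 (real m)" by (cases "m = 0") (auto simp: log_def)
  then have k: "int k = \<lceil>log 2 (real m)\<rceil>" unfolding k_def by simp
  have "m \<le> 2 ^ k"
  proof (cases "m = 0")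
    case False
    have "log 2 (real m) \<le> real k" using k by linarith
    then have "real m \<le> 2 ^ k" using False by (simp add: log_le_iff powr_realpow)
    then show ?thesis by (metis of_nat_le_iff of_nat_numeral of_nat_power)
  qed simp
  then have "covering_number V E \<le> 2 * k + t"
    using tree_covering_number_le[OF assms(1)] assms(2,4) by simp
  \<comment> \<open>The remaining summand \<open>int (sperner_number \<Delta>)\<close> is
    nonnegative.\<close>
  then show ?thesis using k by linarith
qed

end
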